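(* Let $\tau > 0$, let $M \in \mathbb{R}^{n\times n}$ be a symmetric positive definite matrix, let $K \in \mathbb{R}^{n\times n}$, and put $A = \tau M^{-1}K$ and $\hat{A} = M^{1/2} A M^{-1/2}$. Suppose that $\mathcal{W}(K)$ is contained in the left half plane $\{z \in \mathbb{C} : \mathrm{Re}(z) \le 0\}$. Then $\mathcal{W}(\hat{A})$ is also contained in the left half plane $\{z \in \mathbb{C} : \mathrm{Re}(z) \le 0\}$.
   Context: For a square matrix $B \in \mathbb{C}^{n\times n}$, the numerical range (field of values) is $\mathcal{W}(B) = \{v^\ast B v : v \in \mathbb{C}^n, \|v\|_2 = 1\}$. $M^{1/2}$ denotes the symmetric positive definite square root of $M$ and $M^{-1/2}$ its inverse. *)

theory Defs
  imports "HOL-Analysis.Analysis"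
begin

definition spd :: "real^'n^'n \<Rightarrow> bool" where
  "spd M \<longleftrightarrow> transpose M = M \<and> (\<forall>x. x \<noteq> 0 \<longrightarrow> 0 < x \<bullet> (M *v x))"

text \<open>Intended for symmetric positive definite \<open>M\<close>, where such an \<open>R\<close> exists and is unique;
  for other matrices the value is unspecified.\<close>

definition spd_sqrt :: "real^'n^'n \<Rightarrow> real^'n^'n" where
  "spd_sqrt M = (THE R. spd R \<and> R ** R = M)"

text \<open>The library norm on \<open>complex^'n\<close> is the Euclidean norm, and the sum is
  \<open>v\<^sup>* B v\<close>.\<close>

definition numerical_range :: "complex^'n^'n \<Rightarrow> complex set" where
  "numerical_range B = {(\<Sum>i\<in>UNIV. cnj (v $ i) * (B *v v) $ i) | v. norm v = 1}"

definition cmatrix :: "real^'n^'n \<Rightarrow> complex^'n^'n" where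
  "cmatrix = map_matrix complex_of_real"

end

theory Submission
  imports Defs
begin

text \<open>For a real matrix \<open>B\<close> and \<open>v = x + \<i>y\<close> the real part of \<open>v\<^sup>* B v\<close> is
  \<open>x \<bullet> B x + y \<bullet> B y\<close>, so \<open>\<W>(B)\<close> lies in the left half plane iff the real quadratic form of \<open>B\<close>
  is nonpositive. With \<open>R = M\<^sup>1\<^sup>/\<^sup>2\<close> symmetric and \<open>y = R\<^sup>-\<^sup>1 x\<close>, the form of
  \<open>R (\<tau> M\<^sup>-\<^sup>1 K) R\<^sup>-\<^sup>1\<close> at \<open>x\<close> is \<open>\<tau>\<close> times the form of \<open>K\<close> at \<open>y\<close>. Existence of \<open>R\<close> comes from the
  spectral theorem. If \<open>P\<close> and \<open>Q\<close> are two roots and \<open>D = P - Q\<close>, then \<open>P D + D Q = 0\<close>, so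
  the traces of \<open>D P D\<close> and \<open>D Q D\<close>, both nonnegative, sum to \<open>0\<close>; hence \<open>D = 0\<close>.\<close>

section \<open>Spectral theorem for self-adjoint operators\<close>

text \<open>Variational argument: by compactness \<open>x \<bullet> f x\<close> attains a maximum on
  the unit sphere of \<open>S\<close>, and a maximiser is an eigenvector. Working inside an
  invariant subspace lets the result be reused on orthogonal complements.\<close>

lemma selfadjoint_eigenvector_exists:
  fixes f :: "'a::euclidean_space \<Rightarrow> 'a"
  assumes lin: "linear f" and sa: "\<And>x y. f x \<bullet> y = x \<bullet> f y"
    and S: "subspace S" and inv: "f ` S \<subseteq> S" and ne: "S \<noteq> {0}"
  obtains u l where "u \<in> S" "norm u = 1" "f u = l *\<^sub>R u"
proof -
  interpret f: linear f by (rule lin)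
  obtain z where z: "z \<in> S" "z \<noteq> 0"
    using ne subspace_0[OF S] by blast
  have cpt: "compact (sphere 0 1 \<inter> S)"
    by (intro compact_Int_closed compact_sphere closed_subspace S)
  have "sgn z \<in> sphere 0 1 \<inter> S"
    using z S by (simp add: norm_sgn sgn_div_norm subspace_scale)
  moreover have "continuous_on (sphere 0 1 \<inter> S) (\<lambda>x. x \<bullet> f x)"
    by (intro continuous_intros linear_continuous_on f.linear_axioms) (simp add: lin linear_linear)
  ultimately have "\<exists>u\<in>sphere 0 1 \<inter> S. \<forall>y\<in>sphere 0 1 \<inter> S. y \<bullet> f y \<le> u \<bullet> f u"
    by (intro continuous_attains_sup cpt) auto
  then obtain u where u: "u \<in> S" "norm u = 1"
    and max: "\<And>y. y \<in> S \<Longrightarrow> norm y = 1 \<Longrightarrow> y \<bullet> f y \<le> u \<bullet> f u"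
    by auto
  define l where "l = u \<bullet> f u"
  define q where "q x = l * (x \<bullet> x) - x \<bullet> f x" for x
  \<comment> \<open>Both terms of \<open>q\<close> are homogeneous of degree two, so the bound on
    the unit sphere extends to all of \<open>S\<close>.\<close>
  have q_nonneg: "0 \<le> q x" if "x \<in> S" for x
  proof (cases "x = 0")
    case False
    have "sgn x \<bullet> f (sgn x) \<le> l"
      unfolding l_def using False that S
      by (intro max) (simp_all add: norm_sgn sgn_div_norm subspace_scale)
    moreover have "sgn x \<bullet> f (sgn x) = (x \<bullet> f x) / (x \<bullet> x)"
      using False by (simp add: sgn_div_norm f.scale dot_square_norm power2_eq_square field_simps)
    ultimately show ?thesis
      using False by (simp add: q_def divide_le_eq)
  qed (simp add: q_def f.zero)
  \<comment> \<open>\<open>q\<close> has its minimum over \<open>S\<close>, namely 0, at \<open>u\<close>, where its gradient is \<open>2 w\<close>; so \<open>w = 0\<close>.\<close>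
  define w where "w = l *\<^sub>R u - f u"
  \<comment> \<open>With this step, \<open>q (u + t *\<^sub>R w)\<close> comes out as
    \<open>- t\<^sup>2 * (q w + 2)\<close>, which forces \<open>t = 0\<close>. The summand 1 keeps
    the denominator positive even if \<open>q w = 0\<close>.\<close>
  define t where "t = - (w \<bullet> w) / (q w + 1)"
  have "w \<in> S"
    using u inv S by (auto simp: w_def intro!: subspace_diff subspace_scale)
  then have "0 \<le> q (u + t *\<^sub>R w)" and qw: "0 \<le> q w"
    using q_nonneg u(1) S by (auto intro!: q_nonneg subspace_add subspace_scale)
  moreover have "q (u + t *\<^sub>R w) = q u + 2 * t * (w \<bullet> w) + t\<^sup>2 * q w"
  proof -
    \<comment> \<open>Only one factor \<open>w\<close> is unfolded: self-adjointness then identifies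
      the linear coefficient of \<open>q\<close> along \<open>w\<close> as twice
      \<open>w \<bullet> w\<close>.\<close>
    have ww: "w \<bullet> w = l * (u \<bullet> w) - u \<bullet> f w"
      using sa[of u w] by (subst (1) w_def) (simp add: inner_diff_left)
    have "w \<bullet> f u = u \<bullet> f w"
      by (metis inner_commute sa)
    then show ?thesis
      unfolding ww by (simp add: q_def f.add f.scale inner_add inner_commute[of w u] power2_eq_square algebra_simps)
  qed
  moreover have "q u = 0"
    using u(2) by (simp add: q_def l_def dot_square_norm)
  moreover have c: "w \<bullet> w = - t * (q w + 1)"
    using qw by (simp add: t_def)
  ultimately have "t\<^sup>2 * (q w + 2) \<le> 0"
    by (simp add: power2_eq_square algebra_simps)
  then have "t = 0"
    using qw by (simp add: mult_le_0_iff)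
  then have "w = 0"
    using c by simp
  then have "f u = l *\<^sub>R u"
    by (simp add: w_def)
  then show ?thesis
    using that u by blast
qed

text \<open>Induction on the dimension: split off a unit eigenvector \<open>u\<close>.
  Self-adjointness makes its orthogonal complement in \<open>S\<close> invariant again.\<close>

lemma selfadjoint_orthonormal_eigenbasis:
  fixes f :: "'a::euclidean_space \<Rightarrow> 'a"
  assumes lin: "linear f" and sa: "\<And>x y. f x \<bullet> y = x \<bullet> f y"
    and "subspace S" and "f ` S \<subseteq> S"
  shows "\<exists>B. finite B \<and> B \<subseteq> S \<and> pairwise orthogonal B \<and> span B = S \<and>
    (\<forall>b\<in>B. norm b = 1 \<and> (\<exists>l. f b = l *\<^sub>R b))"
  using assms(3,4)
proof (induction "dim S" arbitrary: S rule: less_induct)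
  case less
  show ?case
  proof (cases "S = {0}")
    case True
    then show ?thesis
      by (intro exI[of _ "{}"]) auto
  next
    case False
    then obtain u l where u: "u \<in> S" "norm u = 1" "f u = l *\<^sub>R u"
      using selfadjoint_eigenvector_exists[OF lin sa less.prems] by blast
    have uu: "u \<bullet> u = 1"
      using u(2) by (simp add: dot_square_norm)
    define T where "T = S \<inter> {x. u \<bullet> x = 0}"
    have T: "subspace T"
      unfolding T_def by (intro subspace_inter less.prems subspace_hyperplane)
    have "T \<noteq> S"
      using u(1) uu unfolding T_def by (metis IntE mem_Collect_eq zero_neq_one)
    then have "T \<subset> S"
      by (auto simp: T_def)
    then have "dim T < dim S"
      using T less.prems(1) by (metis dim_psubset span_eq_iff)
    moreover have "f ` T \<subseteq> T"
    proof -
      have "u \<bullet> f x = 0" if "u \<bullet> x = 0" for x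
        using sa[of u x] u(3) that by simp
      then show ?thesis
        using less.prems(2) by (auto simp: T_def)
    qed
    ultimately obtain B where B: "finite B" "B \<subseteq> T" "pairwise orthogonal B" "span B = T"
      "\<And>b. b \<in> B \<Longrightarrow> norm b = 1 \<and> (\<exists>l. f b = l *\<^sub>R b)"
      using less.hyps[OF _ T] by blast
    have "S \<subseteq> span (insert u B)"
    proof
      fix x assume "x \<in> S"
      then have "x - (u \<bullet> x) *\<^sub>R u \<in> T"
        using u(1) uu less.prems(1)
        by (simp add: T_def subspace_diff subspace_scale inner_diff_right)
      then show "x \<in> span (insert u B)"
        using B(4) by (auto simp: span_insert)
    qed
    moreover have "insert u B \<subseteq> S"
      using u(1) B(2) by (auto simp: T_def)
    ultimately have "span (insert u B) = S"
      using less.prems(1) by (metis span_minimal subset_antisym)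
    moreover have "pairwise orthogonal (insert u B)"
      using B(2,3) by (auto simp: pairwise_insert orthogonal_def T_def inner_commute)
    ultimately show ?thesis
      using B(1,5) u \<open>insert u B \<subseteq> S\<close> by (intro exI[of _ "insert u B"]) auto
  qed
qed

section \<open>The square root of a positive definite matrix\<close>

lemma transpose_eq_iff_selfadjoint:
  fixes M :: "real^'n^'n"
  shows "transpose M = M \<longleftrightarrow> (\<forall>x y. (M *v x) \<bullet> y = x \<bullet> (M *v y))"
proof -
  have "(M *v x) \<bullet> y = x \<bullet> (transpose M *v y)" for x y
    by (metis dot_lmul_matrix inner_commute transpose_matrix_vector transpose_transpose)
  then show ?thesis
    by (metis inner_commute matrix_eq vector_eq_rdot)
qed

text \<open>The root keeps the eigenvectors of \<open>M\<close> and replaces each eigenvalue by its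
  square root.\<close>

lemma spd_sqrt_exists:
  fixes M :: "real^'n^'n"
  assumes "spd M"
  shows "\<exists>R. spd R \<and> R ** R = M"
proof -
  have "(M *v x) \<bullet> y = x \<bullet> (M *v y)" for x y
    using assms transpose_eq_iff_selfadjoint[of M] by (auto simp: spd_def)
  then obtain B where B: "finite B" "pairwise orthogonal B" "span B = UNIV"
    and eig: "\<And>b. b \<in> B \<Longrightarrow> norm b = 1 \<and> (\<exists>l. M *v b = l *\<^sub>R b)"
    using selfadjoint_orthonormal_eigenbasis[of "(*v) M" UNIV] by auto
  \<comment> \<open>On a unit eigenvector the quadratic form equals the eigenvalue, so positivity is
    immediate from \<open>spd M\<close>.\<close>
  define l where "l b = b \<bullet> (M *v b)" for b
  have l: "M *v b = l b *\<^sub>R b" "0 < l b" if "b \<in> B" for b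
  proof -
    have "b \<noteq> 0" "b \<bullet> b = 1"
      using eig[OF that] by (auto simp: dot_square_norm)
    then show "M *v b = l b *\<^sub>R b" "0 < l b"
      using eig[OF that] assms by (auto simp: l_def spd_def)
  qed
  define g where "g x = (\<Sum>b\<in>B. (sqrt (l b) * (b \<bullet> x)) *\<^sub>R b)" for x
  have lin: "linear g"
    unfolding g_def
    by (intro linearI) (simp_all add: inner_add_right algebra_simps sum.distrib scaleR_sum_right)
  have gb: "g b = sqrt (l b) *\<^sub>R b" if "b \<in> B" for b
  proof -
    have "(sqrt (l c) * (c \<bullet> b)) *\<^sub>R c = (if c = b then sqrt (l b) *\<^sub>R b else 0)" if "c \<in> B" for c
      using eig[OF \<open>b \<in> B\<close>] that \<open>b \<in> B\<close> B(2)
      by (auto simp: dot_square_norm pairwise_def orthogonal_def)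
    then show ?thesis
      using B(1) that by (simp add: g_def)
  qed
  define R where "R = matrix g"
  have R: "R *v x = g x" for x
    by (simp add: R_def matrix_works lin)
  have "(R *v x) \<bullet> y = x \<bullet> (R *v y)" for x y
    by (simp add: R g_def inner_sum_left inner_sum_right inner_commute[of x] algebra_simps)
  then have "transpose R = R"
    using transpose_eq_iff_selfadjoint by blast
  moreover have "0 < x \<bullet> (R *v x)" if "x \<noteq> 0" for x
  proof -
    have form: "x \<bullet> (R *v x) = (\<Sum>b\<in>B. sqrt (l b) * (b \<bullet> x)\<^sup>2)"
      by (simp add: R g_def inner_sum_right inner_commute[of x] power2_eq_square algebra_simps)
    \<comment> \<open>A vector orthogonal to the whole basis would be orthogonal to itself.\<close>
    have "\<exists>b\<in>B. b \<bullet> x \<noteq> 0"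
    proof (rule ccontr)
      assume "\<not> ?thesis"
      then have "orthogonal x x"
        using orthogonal_to_span[of x B x] B(3) by (simp add: orthogonal_def inner_commute)
      then show False
        using that by (simp add: orthogonal_def)
    qed
    then obtain b where "b \<in> B" "b \<bullet> x \<noteq> 0"
      by blast
    then show ?thesis
      unfolding form using l(2) B(1) by (intro sum_pos2[of B b]) (auto simp: less_imp_le)
  qed
  moreover have "R ** R = M"
  proof -
    have "(R ** R) *v x = M *v x" for x
    proof (rule linear_eq_on_span[of "(*v) (R ** R)" "(*v) M" B])
      show "(R ** R) *v b = M *v b" if "b \<in> B" for b
        using l[OF that] lin
        by (simp add: matrix_vector_mul_assoc[symmetric] R gb[OF that] linear_scale less_imp_le)
    qed (simp_all add: B(3))
    then show ?thesis
      by (simp add: matrix_eq)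
  qed
  ultimately show ?thesis
    by (auto simp: spd_def)
qed

text \<open>The diagonal entries are read off at the standard basis vectors, and symmetry moves the
  left \<open>D\<close> across the inner product. For positive definite \<open>P\<close> every
  summand is thus nonnegative.\<close>

lemma trace_conjugate_eq_sum:
  fixes D P :: "real^'n^'n"
  assumes "transpose D = D"
  shows "trace (D ** P ** D) = (\<Sum>i\<in>UNIV. (D *v axis i 1) \<bullet> (P *v (D *v axis i 1)))"
proof -
  have "trace (D ** P ** D) = (\<Sum>i\<in>UNIV. axis i 1 \<bullet> ((D ** P ** D) *v axis i 1))"
    by (simp add: trace_def inner_axis' matrix_vector_mul_component column_def
        matrix_vector_mult_basis)
  also have "\<dots> = (\<Sum>i\<in>UNIV. (D *v axis i 1) \<bullet> (P *v (D *v axis i 1)))"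
    using assms by (simp add: transpose_eq_iff_selfadjoint matrix_vector_mul_assoc[symmetric])
  finally show ?thesis .
qed

lemma spd_sqrt_unique:
  fixes P Q :: "real^'n^'n"
  assumes P: "spd P" and Q: "spd Q" and eq: "P ** P = Q ** Q"
  shows "P = Q"
proof -
  define D where "D = P - Q"
  have "transpose D = D"
    using P Q by (simp add: D_def spd_def transpose_eq_iff_selfadjoint
        matrix_vector_mult_diff_rdistrib inner_diff)
  note tr = trace_conjugate_eq_sum[OF this]
  \<comment> \<open>The mixed products \<open>P ** Q\<close> cancel, leaving
    \<open>P ** P - Q ** Q\<close>.\<close>
  have "(P ** D + D ** Q) *v x = 0" for x
    using arg_cong[OF eq, of "\<lambda>A. A *v x"]
    by (simp add: D_def matrix_vector_mult_add_rdistrib matrix_vector_mult_diff_rdistrib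
        matrix_vector_mult_diff_distrib flip: matrix_vector_mul_assoc)
  then have "P ** D + D ** Q = 0"
    by (simp add: matrix_eq)
  then have "trace (D ** (P ** D + D ** Q)) = 0"
    by (simp add: trace_def)
  \<comment> \<open>Cyclicity of the trace turns \<open>D ** D ** Q\<close> into
    \<open>D ** Q ** D\<close>.\<close>
  then have "trace (D ** P ** D) + trace (D ** Q ** D) = 0"
    using trace_mul_sym[of "D ** Q" D]
    by (simp add: matrix_add_ldistrib trace_add matrix_mul_assoc)
  moreover have nonneg: "0 \<le> x \<bullet> (S *v x)" if "spd S" for S :: "real^'n^'n" and x
    using that by (cases "x = 0") (auto simp: spd_def less_imp_le)
  then have "0 \<le> trace (D ** Q ** D)" "0 \<le> trace (D ** P ** D)"
    using P Q by (auto simp: tr intro!: sum_nonneg)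
  ultimately have "trace (D ** P ** D) = 0"
    by linarith
  \<comment> \<open>A vanishing sum of nonnegative terms has only zero terms; definiteness of
    \<open>P\<close> then kills every column of \<open>D\<close>.\<close>
  then have "(D *v axis i 1) \<bullet> (P *v (D *v axis i 1)) = 0" for i
    using nonneg[OF P] by (simp add: tr sum_nonneg_eq_0_iff)
  then have "D *v axis i 1 = 0" for i
    using P by (metis less_irrefl spd_def)
  then have "D = 0"
    by (simp add: matrix_vector_mult_basis column_def vec_eq_iff)
  then show ?thesis
    by (simp add: D_def)
qed

lemma spd_sqrt:
  assumes "spd M"
  shows "spd (spd_sqrt M)" "spd_sqrt M ** spd_sqrt M = M"
proof -
  have "\<exists>!R. spd R \<and> R ** R = M"
    using spd_sqrt_exists[OF assms] spd_sqrt_unique by metis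
  from theI'[OF this] show "spd (spd_sqrt M)" "spd_sqrt M ** spd_sqrt M = M"
    by (simp_all add: spd_sqrt_def)
qed

lemma spd_invertible:
  assumes "spd M"
  shows "invertible M"
proof -
  have "x = 0" if "M *v x = 0" for x
    using assms that by (metis inner_zero_right less_irrefl spd_def)
  then show ?thesis
    by (simp add: invertible_left_inverse matrix_left_invertible_ker)
qed

lemma matrix_inv_right:
  assumes "invertible A"
  shows "A ** matrix_inv A = mat 1"
  using someI_ex[OF assms[unfolded invertible_def]] by (simp add: matrix_inv_def)

section \<open>Numerical ranges of real matrices\<close>

text \<open>The cross terms \<open>x \<bullet> (B *v y)\<close> and
  \<open>y \<bullet> (B *v x)\<close> enter only the imaginary part.\<close>

lemma Re_cmatrix_form:
  fixes B :: "real^'n^'n" and v :: "complex^'n"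
  defines "x \<equiv> (\<chi> i. Re (v $ i))" and "y \<equiv> (\<chi> i. Im (v $ i))"
  shows "Re (\<Sum>i\<in>UNIV. cnj (v $ i) * (cmatrix B *v v) $ i) = x \<bullet> (B *v x) + y \<bullet> (B *v y)"
proof -
  have "Re ((cmatrix B *v v) $ i) = (B *v x) $ i" "Im ((cmatrix B *v v) $ i) = (B *v y) $ i" for i
    by (simp_all add: x_def y_def cmatrix_def matrix_vector_mult_def map_matrix_def)
  then show ?thesis
    by (simp add: inner_vec_def sum.distrib) (simp add: x_def y_def)
qed

lemma numerical_range_cmatrix_left_half_plane_iff:
  fixes B :: "real^'n^'n"
  shows "numerical_range (cmatrix B) \<subseteq> {z. Re z \<le> 0} \<longleftrightarrow> (\<forall>x. x \<bullet> (B *v x) \<le> 0)"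
proof
  assume sub: "numerical_range (cmatrix B) \<subseteq> {z. Re z \<le> 0}"
  show "\<forall>x. x \<bullet> (B *v x) \<le> 0"
  proof
    fix x
    show "x \<bullet> (B *v x) \<le> 0"
    proof (cases "x = 0")
      case False
      \<comment> \<open>A real unit vector, read as a complex one, has zero imaginary part, so only
        one real form remains; homogeneity passes from \<open>sgn x\<close> back to
        \<open>x\<close>.\<close>
      define v :: "complex^'n" where "v = (\<chi> i. complex_of_real (sgn x $ i))"
      have "norm v = norm (sgn x)"
        by (simp add: v_def norm_vec_def)
      then have "norm v = 1"
        using False by (simp add: norm_sgn)
      then have "(\<Sum>i\<in>UNIV. cnj (v $ i) * (cmatrix B *v v) $ i) \<in> numerical_range (cmatrix B)"
        unfolding numerical_range_def by blast
      then have "Re (\<Sum>i\<in>UNIV. cnj (v $ i) * (cmatrix B *v v) $ i) \<le> 0"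
        using sub by blast
      moreover have "(\<chi> i. Re (v $ i)) = sgn x" "(\<chi> i. Im (v $ i)) = 0"
        by (simp_all add: v_def vec_eq_iff)
      ultimately have "sgn x \<bullet> (B *v sgn x) \<le> 0"
        unfolding Re_cmatrix_form by simp
      then show ?thesis
        using False
        by (simp add: sgn_div_norm matrix_vector_mult_scaleR zero_le_mult_iff mult_le_0_iff divide_le_0_iff)
    qed simp
  qed
next
  assume "\<forall>x. x \<bullet> (B *v x) \<le> 0"
  then show "numerical_range (cmatrix B) \<subseteq> {z. Re z \<le> 0}"
    unfolding numerical_range_def using Re_cmatrix_form[of _ B]
    by (auto simp del: Re_sum intro!: add_nonpos_nonpos)
qed

theorem proposition3:
  fixes \<tau> :: real and M K A Ahat :: "real^'n^'n"
  assumes "\<tau> > 0"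
    and "spd M"
    and "A = \<tau> *\<^sub>R (matrix_inv M ** K)"
    and "Ahat = spd_sqrt M ** A ** matrix_inv (spd_sqrt M)"
    and "numerical_range (cmatrix K) \<subseteq> {z. Re z \<le> 0}"
  shows "numerical_range (cmatrix Ahat) \<subseteq> {z. Re z \<le> 0}"
proof -
  define R where "R = spd_sqrt M"
  have R: "spd R" "R ** R = M"
    using spd_sqrt[OF assms(2)] by (simp_all add: R_def)
  have R_inv: "R ** matrix_inv R = mat 1"
    by (simp add: matrix_inv_right spd_invertible R)
  have M_inv: "M ** matrix_inv M = mat 1"
    by (simp add: matrix_inv_right spd_invertible assms)
  have "x \<bullet> (Ahat *v x) \<le> 0" for x
  proof -
    define y where "y = matrix_inv R *v x"
    have x: "x = R *v y"
      by (simp add: y_def matrix_vector_mul_assoc R_inv)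
    have "Ahat *v x = R *v (\<tau> *\<^sub>R (matrix_inv M *v (K *v y)))"
      by (simp add: assms(3,4) R_def[symmetric] y_def matrix_vector_mul_assoc[symmetric]
          scaleR_matrix_vector_assoc[symmetric])
    \<comment> \<open>Symmetry moves \<open>R\<close> from \<open>x = R *v y\<close> to the other
      side, where \<open>R ** R = M\<close> then cancels \<open>matrix_inv M\<close>.\<close>
    then have "x \<bullet> (Ahat *v x) = y \<bullet> (R *v (R *v (\<tau> *\<^sub>R (matrix_inv M *v (K *v y)))))"
      using R(1) by (simp add: x spd_def transpose_eq_iff_selfadjoint)
    also have "\<dots> = \<tau> * (y \<bullet> (K *v y))"
      by (simp add: matrix_vector_mul_assoc R(2) M_inv matrix_vector_mult_scaleR matrix_mul_assoc)
    also have "\<dots> \<le> 0"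
      using assms(1,5) by (simp add: numerical_range_cmatrix_left_half_plane_iff mult_le_0_iff)
    finally show ?thesis .
  qed
  then show ?thesis
    by (simp add: numerical_range_cmatrix_left_half_plane_iff)
qed

end
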